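(* Let $(\Omega,\mathcal{F},\mathbf{P})$ be a probability space with a right-continuous and complete filtration $\mathbb{F}=\{\mathcal{F}_t,\ t\in[0,1]\}$, and assume that the $\sigma$-algebra $\mathcal{F}_0$ is degenerate (every set in $\mathcal{F}_0$ has probability $0$ or $1$). Then for every nonnegative square-integrable $\mathbb{F}$-martingale $\{M_t,\ t\in[0,1]\}$ with càdlàg trajectories, $$\mathbf{Ent}\, M_1\le \mathbf{E}\int_0^1\frac{1}{M_{t-}}\,d\langle M\rangle_t .$$
   Context: For a nonnegative random variable $\xi$, its entropy is $\mathbf{Ent}\,\xi=\mathbf{E}[\xi\log\xi]-\mathbf{E}[\xi]\log(\mathbf{E}[\xi])$, with the convention $0\log 0=0$. The filtration is complete in the sense that every $\mathcal{F}_t$ contains all $\mathbf{P}$-null sets from $\mathcal{F}$. $\langle M\rangle$ denotes the predictable quadratic variation of $M$, i.e. the $\mathbb{F}$-predictable nondecreasing process $A$ with $A_0=0$ such that $M^2-A$ is a martingale (the process appearing in the Doob–Meyer decomposition of $M^2$). $M_{t-}$ is the left limit of $M$ at $t$. The integral is a pathwise Lebesgue–Stieltjes integral over $(0,1]$ of a $[0,\infty]$-valued integrand (with $1/0=+\infty$), so the right-hand side takes values in $[0,\infty]$. *)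

theory Defs
  imports "HOL-Probability.Probability"
begin

text \<open>
  Processes and filtrations are functions on all of \<open>real\<close>, but only their values at times in
  \<open>{0..1}\<close> are ever constrained or used.
\<close>

definition usual_filtration :: "'a measure \<Rightarrow> (real \<Rightarrow> 'a measure) \<Rightarrow> bool" where
  "usual_filtration P F \<longleftrightarrow>
     (\<forall>t\<in>{0..1}. subalgebra P (F t)) \<and>
     (\<forall>s\<in>{0..1}. \<forall>t\<in>{0..1}. s \<le> t \<longrightarrow> sets (F s) \<subseteq> sets (F t)) \<and>
     (\<forall>t\<in>{0..<1}. (\<Inter>u\<in>{t<..1}. sets (F u)) = sets (F t)) \<and>
     (\<forall>t\<in>{0..1}. null_sets P \<subseteq> sets (F t))"

definition martingale :: "'a measure \<Rightarrow> (real \<Rightarrow> 'a measure) \<Rightarrow> (real \<Rightarrow> 'a \<Rightarrow> real) \<Rightarrow> bool" where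
  "martingale P F M \<longleftrightarrow>
     (\<forall>t\<in>{0..1}. M t \<in> borel_measurable (F t) \<and> integrable P (M t)) \<and>
     (\<forall>s\<in>{0..1}. \<forall>t\<in>{0..1}. s \<le> t \<longrightarrow> (AE \<omega> in P. real_cond_exp P (F s) (M t) \<omega> = M s \<omega>))"

definition right_continuous_path :: "(real \<Rightarrow> real) \<Rightarrow> bool" where
  "right_continuous_path f \<longleftrightarrow> (\<forall>t\<in>{0..<1}. (f \<longlongrightarrow> f t) (at_right t))"

definition cadlag :: "(real \<Rightarrow> real) \<Rightarrow> bool" where
  "cadlag f \<longleftrightarrow> right_continuous_path f \<and> (\<forall>t\<in>{0<..1}. \<exists>l. (f \<longlongrightarrow> l) (at_left t))"

definition left_lim :: "(real \<Rightarrow> real) \<Rightarrow> real \<Rightarrow> real" where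
  "left_lim f t = Lim (at_left t) f"

definition predictable_sigma :: "'a measure \<Rightarrow> (real \<Rightarrow> 'a measure) \<Rightarrow> (real \<times> 'a) measure" where
  "predictable_sigma P F = sigma ({0..1} \<times> space P)
     ({{0} \<times> B | B. B \<in> sets (F 0)} \<union>
      {{s<..t} \<times> B | s t B. 0 \<le> s \<and> s < t \<and> t \<le> 1 \<and> B \<in> sets (F s)})"

definition predictable :: "'a measure \<Rightarrow> (real \<Rightarrow> 'a measure) \<Rightarrow> (real \<Rightarrow> 'a \<Rightarrow> real) \<Rightarrow> bool" where
  "predictable P F X \<longleftrightarrow> (\<lambda>(t, \<omega>). X t \<omega>) \<in> borel_measurable (predictable_sigma P F)"

text \<open>
  The bracket of \<open>M\<close> is unique only up to indistinguishability, so it is given as a predicate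
  ``\<open>A\<close> is a version of the bracket'', with the path properties required almost surely
  (with one null set for all times). Right-continuity is part of the Doob--Meyer decomposition and
  is needed for that uniqueness.
\<close>

definition predictable_quadratic_variation ::
  "'a measure \<Rightarrow> (real \<Rightarrow> 'a measure) \<Rightarrow> (real \<Rightarrow> 'a \<Rightarrow> real) \<Rightarrow> (real \<Rightarrow> 'a \<Rightarrow> real) \<Rightarrow> bool" where
  "predictable_quadratic_variation P F M A \<longleftrightarrow>
     predictable P F A \<and>
     (AE \<omega> in P. A 0 \<omega> = 0 \<and> mono_on {0..1} (\<lambda>t. A t \<omega>) \<and> right_continuous_path (\<lambda>t. A t \<omega>)) \<and>
     martingale P F (\<lambda>t \<omega>. (M t \<omega>)\<^sup>2 - A t \<omega>)"

text \<open>
  The library's Stieltjes measure needs a distribution function on the whole line, so the path is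
  extended from \<open>{0..1}\<close> by constants; this puts no mass outside \<open>{0<..1}\<close>.
\<close>

definition stieltjes_measure :: "(real \<Rightarrow> real) \<Rightarrow> real measure" where
  "stieltjes_measure a = interval_measure (\<lambda>t. a (max 0 (min 1 t)))"

text \<open>
  Meaningful for nonnegative \<open>\<xi>\<close> with \<open>\<xi>\<close> and \<open>\<xi> * ln \<xi>\<close> integrable, in particular for nonnegative
  square-integrable \<open>\<xi>\<close>, since \<open>\<bar>x * ln x\<bar> \<le> 1 + x\<^sup>2\<close> for \<open>x \<ge> 0\<close>. The convention
  \<open>0 * ln 0 = 0\<close> holds automatically.
\<close>

definition Ent :: "'a measure \<Rightarrow> ('a \<Rightarrow> real) \<Rightarrow> real" where
  "Ent P \<xi> = (\<integral>\<omega>. \<xi> \<omega> * ln (\<xi> \<omega>) \<partial>P) - (\<integral>\<omega>. \<xi> \<omega> \<partial>P) * ln (\<integral>\<omega>. \<xi> \<omega> \<partial>P)"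

end

theory Submission
  imports Defs "HOL-Real_Asymp.Real_Asymp"
begin

text \<open>
  Since \<open>\<F>\<^sub>0\<close> is degenerate, \<open>M\<^sub>0\<close> is almost surely the constant \<open>m = \<E> M\<^sub>1\<close>. With
  \<open>\<phi>(x) = x ln x\<close> the entropy is therefore \<open>\<E> \<phi>(M\<^sub>1) - \<E> \<phi>(M\<^sub>0)\<close>, a quantity that telescopes along
  any partition of the time interval. The property of \<open>\<phi>\<close> that replaces a Taylor expansion
  is \<open>ln z \<le> z - 1\<close> at \<open>z = y / x\<close>, which in the form
  \<open>\<phi>(y) - \<phi>(x) \<le> (y - x) (ln x - 1) + (y\<^sup>2 - x\<^sup>2) / x\<close> (\<open>x_ln_x_increment_le\<close>) bounds the increment
  of \<open>\<phi>\<close> by increments of \<open>M\<close> and \<open>M\<^sup>2\<close> whose coefficients are known at the left end of the step.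
  Taking expectations, the increments of the martingales \<open>M\<close> and \<open>M\<^sup>2 - A\<close> disappear and only
  those of \<open>A\<close> survive (\<open>expectation_x_ln_x_step\<close>).

  The coefficient \<open>1 / x\<close> is unbounded, so all of this is done for \<open>M + c\<close> with \<open>c > 0\<close>,
  which has the same bracket. Then \<open>1 / (M + c) \<le> 1 / c\<close>, and the left Riemann sums of
  \<open>1 / (M + c)\<close> against \<open>dA\<close> are dominated by \<open>(A\<^sub>1 - A\<^sub>0) / c\<close>. Because they evaluate the
  integrand at the left end of each cell, they converge pathwise to the integral of the left limits
  (\<open>left_Riemann_sums_tendsto_stieltjes_integral\<close>), and by dominated convergence also in expectation.
  Finally \<open>1 / (M\<^sub>t\<^sub>- + c) \<le> 1 / M\<^sub>t\<^sub>-\<close> makes the bound independent of \<open>c\<close>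
  (\<open>expectation_x_ln_x_shift_le\<close>), and \<open>c\<close> tends to \<open>0\<close> on the entropy side, where the
  elementary bound \<open>\<phi>(x + c) \<ge> \<phi>(x) + \<phi>(c)\<close> reduces the limit to one of real functions.
\<close>

section \<open>Riemann sums for a Stieltjes measure\<close>

lemma emeasure_stieltjes_Ioc:
  assumes mono: "mono_on {0..1} a" and rc: "right_continuous_path a"
    and "0 \<le> s" "s \<le> t" "t \<le> 1"
  shows "emeasure (stieltjes_measure a) {s<..t} = ennreal (a t - a s)"
proof -
  let ?b = "\<lambda>t. a (max 0 (min 1 t))"
  have b_mono: "?b x \<le> ?b y" if "x \<le> y" for x y
    using that by (intro mono_onD[OF mono]) auto
  have b_rc: "continuous (at_right x) ?b" for x
  proof -
    consider "x < 0" | "0 \<le> x" "x < 1" | "1 \<le> x" by linarith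
    then have "(?b \<longlongrightarrow> ?b x) (at_right x)"
    proof cases
      case 1
      have "eventually (\<lambda>y. ?b y = ?b x) (at_right x)"
        using 1 by (intro eventually_at_rightI[of x 0]) auto
      then show ?thesis by (rule tendsto_eventually)
    next
      case 2
      then have "(a \<longlongrightarrow> a x) (at_right x)"
        using rc by (auto simp: right_continuous_path_def)
      moreover have "eventually (\<lambda>y. a y = ?b y) (at_right x)"
        using 2 by (intro eventually_at_rightI[of x 1]) auto
      ultimately have "(?b \<longlongrightarrow> a x) (at_right x)"
        by (rule Lim_transform_eventually)
      then show ?thesis using 2 by simp
    next
      case 3
      have "eventually (\<lambda>y. ?b y = ?b x) (at_right x)"
        using 3 by (intro eventually_at_rightI[of x "x + 1"]) auto
      then show ?thesis by (rule tendsto_eventually)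
    qed
    then show ?thesis by (simp add: continuous_within)
  qed
  have "emeasure (interval_measure ?b) {s<..t} = ennreal (?b t - ?b s)"
    using assms by (intro emeasure_interval_measure_Ioc b_mono b_rc) auto
  then show ?thesis
    using assms by (simp add: stieltjes_measure_def)
qed

text \<open>
  Identifies the cell containing a point by a ceiling, so that a sum over cells of
  indicators collapses to a single term.
\<close>

lemma Ioc_cell_unique:
  assumes "n > 0"
  shows "t \<in> {real k / real n<..real (Suc k) / real n} \<longleftrightarrow> \<lceil>real n * t\<rceil> = int k + 1"
  using assms by (auto simp: ceiling_eq_iff field_simps)

text \<open>
  The left end of the half-open cell containing \<open>t\<close> lies strictly before \<open>t\<close>, even when \<open>t\<close> is
  itself a grid point; this is why left limits, and not values, appear in the limit of
  the Riemann sums.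
\<close>

lemma left_endpoint_tendsto_at_left:
  fixes t :: real
  assumes "0 < t"
  defines "j \<equiv> \<lambda>n. nat (\<lceil>real n * t\<rceil> - 1)"
  shows "filterlim (\<lambda>n. real (j n) / real n) (at_left t) sequentially"
proof -
  have bounds: "t - 1 / real n \<le> real (j n) / real n \<and> real (j n) / real n < t" if "n > 0" for n
  proof -
    have "\<lceil>real n * t\<rceil> > 0" using that assms by simp
    then have "real (j n) = of_int \<lceil>real n * t\<rceil> - 1"
      by (simp add: j_def)
    then have "real n * t - 1 \<le> real (j n)" "real (j n) < real n * t"
      by linarith+
    then have "(real n * t - 1) / real n \<le> real (j n) / real n" "real (j n) / real n < t"
      using that by (auto intro: divide_right_mono simp: pos_divide_less_eq mult.commute)
    then show ?thesis using that by (simp add: diff_divide_distrib)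
  qed
  have "(\<lambda>n. real (j n) / real n) \<longlonglongrightarrow> t"
  proof (rule tendsto_sandwich)
    show "eventually (\<lambda>n. t - 1 / real n \<le> real (j n) / real n) sequentially"
      using bounds by (intro eventually_sequentiallyI[of 1]) auto
    show "eventually (\<lambda>n. real (j n) / real n \<le> t) sequentially"
      using bounds by (intro eventually_sequentiallyI[of 1]) (auto intro: less_imp_le)
    show "(\<lambda>n. t - 1 / real n) \<longlonglongrightarrow> t" by real_asymp
  qed auto
  moreover have "eventually (\<lambda>n. real (j n) / real n \<in> {..<t} \<and> real (j n) / real n \<noteq> t) sequentially"
  proof (rule eventually_sequentiallyI)
    fix n :: nat assume "1 \<le> n"
    then show "real (j n) / real n \<in> {..<t} \<and> real (j n) / real n \<noteq> t"
      using bounds[of n] by simp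
  qed
  ultimately show ?thesis
    by (simp add: filterlim_at)
qed

text \<open>
  The Riemann sum is the integral of the step function \<open>h n\<close> that takes on each cell the value of
  \<open>g\<close> at its left end. At every point of \<open>{0<..1}\<close> these step functions converge to the left
  limit of \<open>g\<close>, and they are bounded by \<open>C\<close> on a set of finite measure.
\<close>

lemma left_Riemann_sums_tendsto_stieltjes_integral:
  fixes a g :: "real \<Rightarrow> real"
  assumes mono: "mono_on {0..1} a" and rc: "right_continuous_path a"
    and g_lim: "\<And>t. t \<in> {0<..1} \<Longrightarrow> (g \<longlongrightarrow> l t) (at_left t)"
    and g_bounds: "\<And>t. t \<in> {0..1} \<Longrightarrow> 0 \<le> g t \<and> g t \<le> C"
  shows "(\<lambda>n. ennreal (\<Sum>k<n. g (k / n) * (a (Suc k / n) - a (k / n))))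
    \<longlonglongrightarrow> (\<integral>\<^sup>+t\<in>{0<..1}. ennreal (l t) \<partial>stieltjes_measure a)"
proof -
  let ?\<mu> = "stieltjes_measure a"
  define h where "h n t = (\<Sum>k<n. ennreal (g (real k / real n))
      * indicator {real k / real n<..real (Suc k) / real n} t)" for n :: nat and t :: real
  have sets_\<mu> [measurable_cong]: "sets ?\<mu> = sets borel"
    by (simp add: stieltjes_measure_def)
  have h_meas [measurable]: "h n \<in> borel_measurable ?\<mu>" for n
    unfolding h_def by measurable
  have h_outside: "h n t = 0" if "t \<notin> {0<..1}" for n t
  proof -
    have cell: "{real k / real n<..real (Suc k) / real n} \<subseteq> {0<..1}" if "k < n" for k
    proof -
      have "0 \<le> real k / real n" "real (Suc k) / real n \<le> 1"
        using that by (auto simp: field_simps)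
      then show ?thesis by (meson greaterThanAtMost_iff le_less_trans order_trans subsetI)
    qed
    have "h n t = (\<Sum>k<n. 0)"
      unfolding h_def
    proof (intro sum.cong refl)
      fix k assume "k \<in> {..<n}"
      then have "t \<notin> {real k / real n<..real (Suc k) / real n}"
        using cell[of k] that by blast
      then show "ennreal (g (real k / real n))
          * indicator {real k / real n<..real (Suc k) / real n} t = 0"
        by (simp del: of_nat_Suc)
    qed
    then show ?thesis by simp
  qed
  have h_inside: "h n t = ennreal (g (real (nat (\<lceil>real n * t\<rceil> - 1)) / real n))
      \<and> nat (\<lceil>real n * t\<rceil> - 1) < n"
    if "t \<in> {0<..1}" "n > 0" for n t
  proof -
    let ?j = "nat (\<lceil>real n * t\<rceil> - 1)"
    have pos: "\<lceil>real n * t\<rceil> > 0" using that by simp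
    have "\<lceil>real n * t\<rceil> \<le> int n"
      using that by (simp add: ceiling_le_iff mult_left_le)
    then have j: "?j < n" using pos that by linarith
    have "indicator {real k / real n<..real (Suc k) / real n} t = (if k = ?j then 1 else 0 :: ennreal)" for k
      using Ioc_cell_unique[OF that(2), of t k] pos by (auto simp: indicator_def)
    then have "h n t = (\<Sum>k<n. if k = ?j then ennreal (g (real k / real n)) else 0)"
      unfolding h_def by (intro sum.cong) auto
    then show ?thesis using j by (simp add: sum.delta')
  qed
  have "(\<lambda>n. \<integral>\<^sup>+t. h n t \<partial>?\<mu>) \<longlonglongrightarrow> (\<integral>\<^sup>+t. ennreal (l t) * indicator {0<..1} t \<partial>?\<mu>)"
  proof (rule nn_integral_dominated_convergence[where w = "\<lambda>t. ennreal C * indicator {0<..1} t"])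
    have lim: "(\<lambda>n. h n t) \<longlonglongrightarrow> ennreal (l t) * indicator {0<..1} t" for t
    proof (cases "t \<in> {0<..1}")
      case True
      have "((\<lambda>n. g (real (nat (\<lceil>real n * t\<rceil> - 1)) / real n)) \<longlongrightarrow> l t) sequentially"
        using True by (intro filterlim_compose[OF g_lim left_endpoint_tendsto_at_left]) auto
      then have "(\<lambda>n. ennreal (g (real (nat (\<lceil>real n * t\<rceil> - 1)) / real n))) \<longlonglongrightarrow> ennreal (l t)"
        by (rule tendsto_ennrealI)
      moreover have "eventually (\<lambda>n. ennreal (g (real (nat (\<lceil>real n * t\<rceil> - 1)) / real n)) = h n t) sequentially"
        using h_inside[OF True] by (intro eventually_sequentiallyI[of 1]) auto
      ultimately show ?thesis
        using True by (auto intro: Lim_transform_eventually)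
    qed (simp add: h_outside)
    show "AE t in ?\<mu>. (\<lambda>n. h n t) \<longlonglongrightarrow> ennreal (l t) * indicator {0<..1} t"
      using lim by simp
    show "(\<lambda>t. ennreal (l t) * indicator {0<..1} t) \<in> borel_measurable ?\<mu>"
      by (rule borel_measurable_LIMSEQ_order[where u = h, OF lim h_meas])
    show "AE t in ?\<mu>. h n t \<le> ennreal C * indicator {0<..1} t" for n
    proof (rule AE_I2)
      fix t
      show "h n t \<le> ennreal C * indicator {0<..1} t"
      proof (cases "t \<in> {0<..1} \<and> n > 0")
        case True
        then show ?thesis
          using h_inside[of t n] g_bounds[of "real (nat (\<lceil>real n * t\<rceil> - 1)) / real n"]
          by (auto intro!: ennreal_leI)
      next
        case False
        have "h n t = 0"
        proof (cases "n = 0")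
          case True
          then show ?thesis by (simp add: h_def)
        next
          case n: False
          with False have "t \<notin> {0<..1}" by simp
          then show ?thesis by (rule h_outside)
        qed
        then show ?thesis by simp
      qed
    qed
    show "(\<integral>\<^sup>+t. ennreal C * indicator {0<..1} t \<partial>?\<mu>) < \<infinity>"
      using emeasure_stieltjes_Ioc[OF mono rc, of 0 1]
      by (simp add: nn_integral_cmult_indicator ennreal_mult_less_top)
  qed auto
  moreover have "(\<integral>\<^sup>+t. h n t \<partial>?\<mu>) = ennreal (\<Sum>k<n. g (k / n) * (a (Suc k / n) - a (k / n)))" for n
  proof -
    have cell: "0 \<le> g (k / n) \<and> 0 \<le> a (Suc k / n) - a (k / n) \<and>
      emeasure ?\<mu> {real k / real n<..real (Suc k) / real n} = ennreal (a (Suc k / n) - a (k / n))"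
      if "k < n" for k
    proof -
      have "0 \<le> real k / real n" "real k / real n \<le> real (Suc k) / real n" "real (Suc k) / real n \<le> 1"
        using that by (auto simp: field_simps)
      then show ?thesis
        using emeasure_stieltjes_Ioc[OF mono rc] g_bounds[of "k / n"]
          mono_onD[OF mono, of "k / n" "Suc k / n"] by auto
    qed
    have "(\<integral>\<^sup>+t. h n t \<partial>?\<mu>)
      = (\<Sum>k<n. ennreal (g (k / n)) * emeasure ?\<mu> {real k / real n<..real (Suc k) / real n})"
      unfolding h_def by (subst nn_integral_sum) (auto simp: nn_integral_cmult_indicator)
    also have "\<dots> = (\<Sum>k<n. ennreal (g (k / n) * (a (Suc k / n) - a (k / n))))"
      using cell by (intro sum.cong) (auto simp: ennreal_mult)
    also have "\<dots> = ennreal (\<Sum>k<n. g (k / n) * (a (Suc k / n) - a (k / n)))"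
      using cell by (intro sum_ennreal) auto
    finally show ?thesis .
  qed
  ultimately show ?thesis by simp
qed

section \<open>Elementary inequalities for \<open>x ln x\<close>\<close>

text \<open>
  This is \<open>ln (y / x) \<le> y / x - 1\<close> multiplied by \<open>y\<close>. The right-hand side is arranged as a combination
  of \<open>y - x\<close> and \<open>y\<^sup>2 - x\<^sup>2\<close> with coefficients depending on \<open>x\<close> alone: these are the increments that
  can be integrated against information available at the earlier time.
\<close>

lemma x_ln_x_increment_le:
  fixes x y :: real
  assumes "0 < x" "0 < y"
  shows "y * ln y - x * ln x \<le> (y - x) * (ln x - 1) + (y\<^sup>2 - x\<^sup>2) / x"
proof -
  have "ln (y / x) \<le> y / x - 1"
    using assms by (intro ln_le_minus_one) auto
  then have "ln y - ln x \<le> y / x - 1"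
    using assms by (simp add: ln_div)
  then have "y * (ln y - ln x) \<le> y * (y / x - 1)"
    using assms by (intro mult_left_mono) auto
  then show ?thesis
    using assms by (simp add: field_simps power2_eq_square)
qed

lemma abs_ln_le:
  fixes x c :: real
  assumes "0 < c" "c \<le> x"
  shows "\<bar>ln x\<bar> \<le> \<bar>ln c\<bar> + x"
proof -
  have "ln c \<le> ln x" "ln x \<le> x - 1"
    using assms by (auto intro: ln_le_minus_one)
  then show ?thesis using assms by linarith
qed

lemma abs_x_ln_x_le:
  fixes x :: real
  assumes "0 \<le> x"
  shows "\<bar>x * ln x\<bar> \<le> 1 + x\<^sup>2"
proof (cases "x = 0")
  case False
  then have x: "0 < x" using assms by simp
  have "ln x \<le> x - 1" "ln (1 / x) \<le> 1 / x - 1"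
    using x by (auto intro: ln_le_minus_one)
  then have "ln x \<le> x" "- ln x \<le> 1 / x"
    using x by (auto simp: ln_div)
  then have "x * ln x \<le> x * x" "x * (- ln x) \<le> x * (1 / x)"
    using x by (intro mult_left_mono; simp)+
  then have "x * ln x \<le> x\<^sup>2" "- (x * ln x) \<le> 1"
    using x by (auto simp: power2_eq_square)
  moreover have "0 \<le> x\<^sup>2" by simp
  ultimately show ?thesis by linarith
qed simp

text \<open>
  Split \<open>(x + c) ln (x + c)\<close> as \<open>x ln (x + c) + c ln (x + c)\<close> and use monotonicity of \<open>ln\<close> in each
  term. The gain over convexity estimates is that the error \<open>c ln c\<close> does not depend
  on \<open>x\<close>, so the shift can be removed under an expectation.
\<close>

lemma x_ln_x_shift_ge:
  fixes x c :: real
  assumes "0 \<le> x" "0 < c"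
  shows "x * ln x + c * ln c \<le> (x + c) * ln (x + c)"
proof (cases "x = 0")
  case False
  then have "x * ln x \<le> x * ln (x + c)" "c * ln c \<le> c * ln (x + c)"
    using assms by (auto intro!: mult_left_mono)
  then show ?thesis by (simp add: algebra_simps)
qed simp

lemma tendsto_x_ln_x_shift:
  fixes m :: real
  assumes "0 \<le> m"
  shows "((\<lambda>c. (m + c) * ln (m + c)) \<longlongrightarrow> m * ln m) (at_right 0)"
proof (cases "m = 0")
  case True
  have "((\<lambda>c::real. c * ln c) \<longlongrightarrow> 0) (at_right 0)" by real_asymp
  then show ?thesis using True by simp
next
  case False
  then have "((\<lambda>c. (m + c) * ln (m + c)) \<longlongrightarrow> (m + 0) * ln (m + 0)) (at_right 0)"
    using assms by (intro tendsto_intros) auto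
  then show ?thesis by simp
qed

section \<open>Martingale increments\<close>

text \<open>
  A factor \<open>f\<close> known at time \<open>s\<close> passes through the conditional expectation given the past
  of \<open>s\<close>. Integrability is assumed of the products because the factor applied later contains a
  logarithm and is unbounded.
\<close>

lemma martingale_increment_orthogonal:
  assumes "prob_space P" and sub: "subalgebra P (F s)" and mart: "martingale P F X"
    and st: "0 \<le> s" "s \<le> t" "t \<le> 1"
    and f: "f \<in> borel_measurable (F s)"
    and int_s: "integrable P (\<lambda>\<omega>. f \<omega> * X s \<omega>)" and int_t: "integrable P (\<lambda>\<omega>. f \<omega> * X t \<omega>)"
  shows "integrable P (\<lambda>\<omega>. f \<omega> * (X t \<omega> - X s \<omega>)) \<and> (\<integral>\<omega>. f \<omega> * (X t \<omega> - X s \<omega>) \<partial>P) = 0"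
proof -
  interpret prob_space P by fact
  interpret finite_measure_subalgebra P "F s" by unfold_locales (rule sub)
  have Xt: "X t \<in> borel_measurable P" and Xs: "X s \<in> borel_measurable P"
    using mart st by (auto simp: martingale_def)
  have cond: "AE \<omega> in P. real_cond_exp P (F s) (X t) \<omega> = X s \<omega>"
    using mart st by (simp add: martingale_def)
  have "(\<integral>\<omega>. f \<omega> * X t \<omega> \<partial>P) = (\<integral>\<omega>. f \<omega> * real_cond_exp P (F s) (X t) \<omega> \<partial>P)"
    using real_cond_exp_intg(2)[OF int_t f Xt] by simp
  also have "\<dots> = (\<integral>\<omega>. f \<omega> * X s \<omega> \<partial>P)"
    using cond real_cond_exp_intg(1)[OF int_t f Xt] int_s
    by (intro integral_cong_AE) (auto dest: borel_measurable_integrable)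
  finally show ?thesis
    using int_s int_t by (simp add: right_diff_distrib)
qed

text \<open>
  Each of the events \<open>X < \<E> X\<close> and \<open>X > \<E> X\<close> has probability \<open>0\<close> or \<open>1\<close>, and probability \<open>1\<close> would
  make the expectation of \<open>X\<close> strictly smaller, respectively larger, than itself.
\<close>

lemma AE_eq_expectation_if_trivial:
  fixes X :: "'a \<Rightarrow> real"
  assumes "prob_space P" and sub: "subalgebra P G"
    and trivial: "\<forall>B\<in>sets G. measure P B = 0 \<or> measure P B = 1"
    and X: "X \<in> borel_measurable G" and int: "integrable P X"
  shows "AE \<omega> in P. X \<omega> = (\<integral>\<omega>. X \<omega> \<partial>P)"
proof -
  interpret prob_space P by fact
  let ?m = "\<integral>\<omega>. X \<omega> \<partial>P"
  have space: "space G = space P" and sets: "sets G \<subseteq> sets P"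
    using sub by (auto simp: subalgebra_def)
  have lt: "{\<omega>\<in>space P. X \<omega> < ?m} \<in> sets G" and gt: "{\<omega>\<in>space P. ?m < X \<omega>} \<in> sets G"
    using X by (simp_all add: space[symmetric])
  have ltP: "{\<omega>\<in>space P. X \<omega> < ?m} \<in> sets P" and gtP: "{\<omega>\<in>space P. ?m < X \<omega>} \<in> sets P"
    using lt gt sets by blast+
  have lt0: "prob {\<omega>\<in>space P. X \<omega> < ?m} = 0"
  proof (rule ccontr)
    assume "prob {\<omega>\<in>space P. X \<omega> < ?m} \<noteq> 0"
    then have "prob {\<omega>\<in>space P. X \<omega> < ?m} = 1"
      using trivial lt by blast
    then have "AE \<omega> in P. X \<omega> < ?m"
      using prob_Collect_eq_1[OF ltP] by simp
    then show False
      using expectation_less[OF int] by auto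
  qed
  have gt0: "prob {\<omega>\<in>space P. ?m < X \<omega>} = 0"
  proof (rule ccontr)
    assume "prob {\<omega>\<in>space P. ?m < X \<omega>} \<noteq> 0"
    then have "prob {\<omega>\<in>space P. ?m < X \<omega>} = 1"
      using trivial gt by blast
    then have "AE \<omega> in P. ?m < X \<omega>"
      using prob_Collect_eq_1[OF gtP] by simp
    then show False
      using expectation_greater[OF int] by auto
  qed
  have "AE \<omega> in P. \<not> X \<omega> < ?m"
    using lt0 prob_Collect_eq_0[OF ltP] by simp
  moreover have "AE \<omega> in P. \<not> ?m < X \<omega>"
    using gt0 prob_Collect_eq_0[OF gtP] by simp
  ultimately show ?thesis by eventually_elim linarith
qed

section \<open>The entropy bound\<close>

text \<open>
  The part of the argument at fixed times uses only that \<open>A\<close> compensates \<open>M\<^sup>2\<close>. Path properties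
  enter with the passage to the limit and are added in a second locale.
\<close>

locale bracketed_martingale = prob_space P for P :: "'a measure" +
  fixes F :: "real \<Rightarrow> 'a measure" and M A :: "real \<Rightarrow> 'a \<Rightarrow> real"
  assumes subalgebra: "\<And>t. t \<in> {0..1} \<Longrightarrow> subalgebra P (F t)"
    and M_martingale: "martingale P F M"
    and M_square_integrable: "\<And>t. t \<in> {0..1} \<Longrightarrow> integrable P (\<lambda>\<omega>. (M t \<omega>)\<^sup>2)"
    and M_nonneg: "\<And>t \<omega>. t \<in> {0..1} \<Longrightarrow> \<omega> \<in> space P \<Longrightarrow> 0 \<le> M t \<omega>"
    and compensated: "martingale P F (\<lambda>t \<omega>. (M t \<omega>)\<^sup>2 - A t \<omega>)"
begin

lemma M_measurable_F: "t \<in> {0..1} \<Longrightarrow> M t \<in> borel_measurable (F t)"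
  and M_integrable: "t \<in> {0..1} \<Longrightarrow> integrable P (M t)"
  using M_martingale by (auto simp: martingale_def)

lemma A_integrable: "t \<in> {0..1} \<Longrightarrow> integrable P (A t)"
proof -
  assume t: "t \<in> {0..1}"
  then have "integrable P (\<lambda>\<omega>. (M t \<omega>)\<^sup>2 - A t \<omega>)"
    using compensated by (simp add: martingale_def)
  from Bochner_Integration.integrable_diff[OF M_square_integrable[OF t] this]
  show ?thesis by simp
qed

lemma square_shift_integrable:
  assumes "t \<in> {0..1}"
  shows "integrable P (\<lambda>\<omega>. (M t \<omega> + c)\<^sup>2)"
  using assms M_square_integrable M_integrable
  by (simp add: power2_sum)

lemma x_ln_x_shift_integrable:
  assumes t: "t \<in> {0..1}" and c: "0 \<le> c"
  shows "integrable P (\<lambda>\<omega>. (M t \<omega> + c) * ln (M t \<omega> + c))"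
proof (rule Bochner_Integration.integrable_bound)
  show "integrable P (\<lambda>\<omega>. 1 + (M t \<omega> + c)\<^sup>2)"
    using square_shift_integrable[OF t] by simp
  show "(\<lambda>\<omega>. (M t \<omega> + c) * ln (M t \<omega> + c)) \<in> borel_measurable P"
    using M_integrable[OF t] by (auto dest: borel_measurable_integrable)
  show "AE \<omega> in P. norm ((M t \<omega> + c) * ln (M t \<omega> + c)) \<le> norm (1 + (M t \<omega> + c)\<^sup>2)"
    using M_nonneg[OF t] c abs_x_ln_x_le by (intro AE_I2) (force intro: order_trans)
qed

lemma bounded_times_integrable:
  fixes f X :: "'a \<Rightarrow> real"
  assumes "integrable P X" "f \<in> borel_measurable P" "\<And>\<omega>. \<omega> \<in> space P \<Longrightarrow> \<bar>f \<omega>\<bar> \<le> C"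
  shows "integrable P (\<lambda>\<omega>. f \<omega> * X \<omega>)"
proof (rule Bochner_Integration.integrable_bound)
  show "integrable P (\<lambda>\<omega>. C * X \<omega>)" using assms(1) by simp
  show "(\<lambda>\<omega>. f \<omega> * X \<omega>) \<in> borel_measurable P"
    using assms by (auto dest: borel_measurable_integrable)
  show "AE \<omega> in P. norm (f \<omega> * X \<omega>) \<le> norm (C * X \<omega>)"
    using assms(3) by (intro AE_I2) (force simp: abs_mult intro: mult_right_mono)
qed

text \<open>
  The shift by \<open>c\<close> bounds the logarithm from below, so that it grows at most linearly in \<open>M\<close>;
  the product is then controlled by squares.
\<close>

lemma ln_shift_times_M_integrable:
  assumes s: "s \<in> {0..1}" and t: "t \<in> {0..1}" and c: "0 < c"
  shows "integrable P (\<lambda>\<omega>. ln (M s \<omega> + c) * M t \<omega>)"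
proof (rule Bochner_Integration.integrable_bound)
  show "integrable P (\<lambda>\<omega>. \<bar>ln c\<bar> * M t \<omega> + (M s \<omega> + c)\<^sup>2 + (M t \<omega>)\<^sup>2)"
    using M_integrable[OF t] square_shift_integrable[OF s] M_square_integrable[OF t] by simp
  show "(\<lambda>\<omega>. ln (M s \<omega> + c) * M t \<omega>) \<in> borel_measurable P"
    using M_integrable[OF t] M_integrable[OF s] by (auto dest: borel_measurable_integrable)
  show "AE \<omega> in P. norm (ln (M s \<omega> + c) * M t \<omega>)
      \<le> norm (\<bar>ln c\<bar> * M t \<omega> + (M s \<omega> + c)\<^sup>2 + (M t \<omega>)\<^sup>2)"
  proof (rule AE_I2)
    fix \<omega> assume \<omega>: "\<omega> \<in> space P"
    let ?x = "M s \<omega> + c" and ?y = "M t \<omega>"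
    have nn: "0 \<le> M s \<omega>" "0 \<le> ?y" using M_nonneg \<omega> s t by auto
    have "\<bar>ln ?x\<bar> * ?y \<le> (\<bar>ln c\<bar> + ?x) * ?y"
      using nn c by (intro mult_right_mono abs_ln_le) auto
    also have "?x * ?y \<le> ?x\<^sup>2 + ?y\<^sup>2"
      using sum_squares_bound[of ?x ?y] mult_nonneg_nonneg[of ?x ?y] nn c by linarith
    then have "(\<bar>ln c\<bar> + ?x) * ?y \<le> \<bar>ln c\<bar> * ?y + ?x\<^sup>2 + ?y\<^sup>2"
      by (simp add: algebra_simps)
    finally show "norm (ln ?x * ?y) \<le> norm (\<bar>ln c\<bar> * ?y + ?x\<^sup>2 + ?y\<^sup>2)"
      using nn by (simp add: abs_mult)
  qed
qed

lemma increment_quotient_integrable: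
  assumes "r \<in> {0..1}" "s \<in> {0..1}" "t \<in> {0..1}" "0 < c"
  shows "integrable P (\<lambda>\<omega>. 1 / (M r \<omega> + c) * (A t \<omega> - A s \<omega>))"
proof (rule bounded_times_integrable[where C = "1 / c"])
  show "integrable P (\<lambda>\<omega>. A t \<omega> - A s \<omega>)"
    using A_integrable assms by simp
  show "(\<lambda>\<omega>. 1 / (M r \<omega> + c)) \<in> borel_measurable P"
    using M_integrable[OF assms(1)] by (auto dest: borel_measurable_integrable)
  show "\<bar>1 / (M r \<omega> + c)\<bar> \<le> 1 / c" if "\<omega> \<in> space P" for \<omega>
    using M_nonneg[OF assms(1) that] assms by (simp add: frac_le)
qed

text \<open>
  Put \<open>x = M\<^sub>s + c\<close> and \<open>y = M\<^sub>t + c\<close> in \<open>x_ln_x_increment_le\<close>. Here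
  \<open>y\<^sup>2 - x\<^sup>2\<close> is \<open>2 c (M\<^sub>t - M\<^sub>s) + (N\<^sub>t - N\<^sub>s) + (A\<^sub>t - A\<^sub>s)\<close> with the martingale \<open>N = M\<^sup>2 - A\<close>. Collecting
  terms, \<open>f\<close> multiplies the increment of \<open>M\<close> and \<open>g = 1 / x\<close> those of \<open>N\<close> and \<open>A\<close>;
  the first two products have expectation zero.
\<close>

lemma expectation_x_ln_x_step:
  assumes st: "0 \<le> s" "s \<le> t" "t \<le> 1" and c: "0 < c"
  shows "(\<integral>\<omega>. (M t \<omega> + c) * ln (M t \<omega> + c) \<partial>P) - (\<integral>\<omega>. (M s \<omega> + c) * ln (M s \<omega> + c) \<partial>P)
    \<le> (\<integral>\<omega>. 1 / (M s \<omega> + c) * (A t \<omega> - A s \<omega>) \<partial>P)"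
proof -
  have s: "s \<in> {0..1}" and t: "t \<in> {0..1}" using st by auto
  let ?N = "\<lambda>t \<omega>. (M t \<omega>)\<^sup>2 - A t \<omega>"
  let ?f = "\<lambda>\<omega>. ln (M s \<omega> + c) + 2 * c * (1 / (M s \<omega> + c)) - 1"
  let ?g = "\<lambda>\<omega>. 1 / (M s \<omega> + c)"
  note [measurable] = M_measurable_F[OF s]
  have g_F: "?g \<in> borel_measurable (F s)" and f_F: "?f \<in> borel_measurable (F s)"
    by measurable
  have g_P: "?g \<in> borel_measurable P"
    using measurable_from_subalg[OF subalgebra[OF s] g_F] .
  have g_bound: "\<bar>?g \<omega>\<bar> \<le> 1 / c" if "\<omega> \<in> space P" for \<omega>
    using M_nonneg[OF s that] c by (simp add: frac_le)
  have gX: "integrable P (\<lambda>\<omega>. ?g \<omega> * X \<omega>)" if "integrable P X" for X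
    using bounded_times_integrable[OF that g_P g_bound] .
  have fM: "integrable P (\<lambda>\<omega>. ?f \<omega> * M u \<omega>)" if "u \<in> {0..1}" for u
  proof -
    have "integrable P (\<lambda>\<omega>. ln (M s \<omega> + c) * M u \<omega> + 2 * c * (?g \<omega> * M u \<omega>) - M u \<omega>)"
      using ln_shift_times_M_integrable[OF s that c] gX[OF M_integrable[OF that]] M_integrable[OF that]
      by (intro Bochner_Integration.integrable_diff Bochner_Integration.integrable_add
          integrable_mult_right) auto
    then show ?thesis by (simp add: algebra_simps)
  qed
  have gN: "integrable P (\<lambda>\<omega>. ?g \<omega> * ?N u \<omega>)" if "u \<in> {0..1}" for u
    using that A_integrable M_square_integrable by (intro gX) auto
  have mart_f: "integrable P (\<lambda>\<omega>. ?f \<omega> * (M t \<omega> - M s \<omega>)) \<and> (\<integral>\<omega>. ?f \<omega> * (M t \<omega> - M s \<omega>) \<partial>P) = 0"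
    using martingale_increment_orthogonal[OF prob_space_axioms subalgebra[OF s] M_martingale st f_F
        fM[OF s] fM[OF t]] .
  have mart_g: "integrable P (\<lambda>\<omega>. ?g \<omega> * (?N t \<omega> - ?N s \<omega>)) \<and> (\<integral>\<omega>. ?g \<omega> * (?N t \<omega> - ?N s \<omega>) \<partial>P) = 0"
    using martingale_increment_orthogonal[OF prob_space_axioms subalgebra[OF s] compensated st g_F
        gN[OF s] gN[OF t]] .
  have gA: "integrable P (\<lambda>\<omega>. ?g \<omega> * (A t \<omega> - A s \<omega>))"
    using increment_quotient_integrable[OF s s t c] .
  note int_t = x_ln_x_shift_integrable[OF t less_imp_le[OF c]]
    and int_s = x_ln_x_shift_integrable[OF s less_imp_le[OF c]]
  have split: "d * (l - 1) + (2 * c * d + n + a) / x = (l + 2 * c * (1 / x) - 1) * d + 1 / x * n + 1 / x * a"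
    for d l n a x :: real
    by (simp add: add_divide_distrib algebra_simps)
  have "(\<integral>\<omega>. (M t \<omega> + c) * ln (M t \<omega> + c) \<partial>P) - (\<integral>\<omega>. (M s \<omega> + c) * ln (M s \<omega> + c) \<partial>P)
      = (\<integral>\<omega>. (M t \<omega> + c) * ln (M t \<omega> + c) - (M s \<omega> + c) * ln (M s \<omega> + c) \<partial>P)"
    using int_t int_s by simp
  also have "\<dots> \<le> (\<integral>\<omega>. ?f \<omega> * (M t \<omega> - M s \<omega>) + ?g \<omega> * (?N t \<omega> - ?N s \<omega>) + ?g \<omega> * (A t \<omega> - A s \<omega>) \<partial>P)"
  proof (rule integral_mono)
    fix \<omega> assume \<omega>: "\<omega> \<in> space P"
    let ?x = "M s \<omega> + c" and ?y = "M t \<omega> + c"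
    have pos: "0 < ?x" "0 < ?y" using M_nonneg[OF s \<omega>] M_nonneg[OF t \<omega>] c by auto
    have "?y * ln ?y - ?x * ln ?x \<le> (?y - ?x) * (ln ?x - 1) + (?y\<^sup>2 - ?x\<^sup>2) / ?x"
      by (rule x_ln_x_increment_le[OF pos])
    also have "?y\<^sup>2 - ?x\<^sup>2 = 2 * c * (M t \<omega> - M s \<omega>) + (?N t \<omega> - ?N s \<omega>) + (A t \<omega> - A s \<omega>)"
      by (simp add: power2_eq_square algebra_simps)
    also have "?y - ?x = M t \<omega> - M s \<omega>" by simp
    also have "(M t \<omega> - M s \<omega>) * (ln ?x - 1)
          + (2 * c * (M t \<omega> - M s \<omega>) + (?N t \<omega> - ?N s \<omega>) + (A t \<omega> - A s \<omega>)) / ?x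
        = ?f \<omega> * (M t \<omega> - M s \<omega>) + ?g \<omega> * (?N t \<omega> - ?N s \<omega>) + ?g \<omega> * (A t \<omega> - A s \<omega>)"
      by (rule split)
    finally show "?y * ln ?y - ?x * ln ?x
        \<le> ?f \<omega> * (M t \<omega> - M s \<omega>) + ?g \<omega> * (?N t \<omega> - ?N s \<omega>) + ?g \<omega> * (A t \<omega> - A s \<omega>)" .
  qed (use mart_f mart_g gA int_t int_s in auto)
  also have "\<dots> = (\<integral>\<omega>. ?g \<omega> * (A t \<omega> - A s \<omega>) \<partial>P)"
    using mart_f mart_g gA by simp
  finally show ?thesis .
qed

lemma expectation_x_ln_x_le_Riemann_sum:
  assumes c: "0 < c" and n: "0 < n"
  shows "(\<integral>\<omega>. (M 1 \<omega> + c) * ln (M 1 \<omega> + c) \<partial>P) - (\<integral>\<omega>. (M 0 \<omega> + c) * ln (M 0 \<omega> + c) \<partial>P)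
    \<le> (\<integral>\<omega>. (\<Sum>k<n. 1 / (M (k / n) \<omega> + c) * (A (Suc k / n) \<omega> - A (k / n) \<omega>)) \<partial>P)"
proof -
  define e where "e k = (\<integral>\<omega>. (M (real k / n) \<omega> + c) * ln (M (real k / n) \<omega> + c) \<partial>P)" for k :: nat
  have grid: "0 \<le> real k / real n" "real k / real n \<le> real (Suc k) / real n" "real (Suc k) / real n \<le> 1"
    if "k < n" for k
    using that by (auto simp: field_simps)
  have "(\<integral>\<omega>. (M 1 \<omega> + c) * ln (M 1 \<omega> + c) \<partial>P) - (\<integral>\<omega>. (M 0 \<omega> + c) * ln (M 0 \<omega> + c) \<partial>P) = e n - e 0"
    using n by (simp add: e_def)
  also have "\<dots> = (\<Sum>k<n. e (Suc k) - e k)"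
    by (rule sum_lessThan_telescope[symmetric])
  also have "\<dots> \<le> (\<Sum>k<n. \<integral>\<omega>. 1 / (M (k / n) \<omega> + c) * (A (Suc k / n) \<omega> - A (k / n) \<omega>) \<partial>P)"
    unfolding e_def using grid c by (intro sum_mono expectation_x_ln_x_step) auto
  also have "\<dots> = (\<integral>\<omega>. (\<Sum>k<n. 1 / (M (k / n) \<omega> + c) * (A (Suc k / n) \<omega> - A (k / n) \<omega>)) \<partial>P)"
  proof (rule Bochner_Integration.integral_sum[symmetric])
    fix k assume "k \<in> {..<n}"
    then have "real k / n \<in> {0..1}" "real (Suc k) / n \<in> {0..1}"
      using grid[of k] by (auto intro: order_trans)
    then show "integrable P (\<lambda>\<omega>. 1 / (M (k / n) \<omega> + c) * (A (Suc k / n) \<omega> - A (k / n) \<omega>))"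
      using c by (intro increment_quotient_integrable) auto
  qed
  finally show ?thesis .
qed

end

locale bracketed_cadlag_martingale = bracketed_martingale +
  assumes M_cadlag: "\<And>\<omega>. \<omega> \<in> space P \<Longrightarrow> cadlag (\<lambda>t. M t \<omega>)"
    and A_paths: "AE \<omega> in P. mono_on {0..1} (\<lambda>t. A t \<omega>) \<and> right_continuous_path (\<lambda>t. A t \<omega>)"
begin

lemma tendsto_left_lim:
  assumes "\<omega> \<in> space P" "t \<in> {0<..1}"
  shows "((\<lambda>s. M s \<omega>) \<longlongrightarrow> left_lim (\<lambda>s. M s \<omega>) t) (at_left t)"
proof -
  obtain l where l: "((\<lambda>s. M s \<omega>) \<longlongrightarrow> l) (at_left t)"
    using M_cadlag[OF assms(1)] assms(2) unfolding cadlag_def by blast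
  then have "left_lim (\<lambda>s. M s \<omega>) t = l"
    unfolding left_lim_def by (intro tendsto_Lim) auto
  then show ?thesis using l by simp
qed

lemma left_lim_nonneg:
  assumes "\<omega> \<in> space P" "t \<in> {0<..1}"
  shows "0 \<le> left_lim (\<lambda>s. M s \<omega>) t"
proof (rule tendsto_lowerbound[OF tendsto_left_lim[OF assms]])
  show "eventually (\<lambda>s. 0 \<le> M s \<omega>) (at_left t)"
    using assms by (intro eventually_at_leftI[of 0]) (auto intro!: M_nonneg)
qed auto

text \<open>
  The expected Riemann sums converge, as the mesh tends to zero, to the expected integral of
  \<open>1 / (M\<^sub>t\<^sub>- + c)\<close>. The domination rests on the monotone paths of \<open>A\<close>: with weights in
  \<open>[0, 1 / c]\<close>, the sums lie between \<open>0\<close> and \<open>(A\<^sub>1 - A\<^sub>0) / c\<close>.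
\<close>

lemma expectation_x_ln_x_shift_le:
  assumes c: "0 < c"
  shows "ereal ((\<integral>\<omega>. (M 1 \<omega> + c) * ln (M 1 \<omega> + c) \<partial>P) - (\<integral>\<omega>. (M 0 \<omega> + c) * ln (M 0 \<omega> + c) \<partial>P))
    \<le> enn2ereal (\<integral>\<^sup>+\<omega>. (\<integral>\<^sup>+t\<in>{0<..1}. 1 / ennreal (left_lim (\<lambda>s. M s \<omega>) t)
        \<partial>stieltjes_measure (\<lambda>t. A t \<omega>)) \<partial>P)"
    (is "ereal ?d \<le> enn2ereal (\<integral>\<^sup>+\<omega>. ?J \<omega> \<partial>P)")
proof -
  define S where "S n \<omega> = (\<Sum>k<n. 1 / (M (k / n) \<omega> + c) * (A (Suc k / n) \<omega> - A (k / n) \<omega>))"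
    for n :: nat and \<omega>
  have grid: "real k / real n \<in> {0..1}" "real (Suc k) / real n \<in> {0..1}"
      "real k / real n \<le> real (Suc k) / real n" if "k < n" for k n
    using that by (auto simp: field_simps)
  let ?I = "\<lambda>\<omega>. \<integral>\<^sup>+t\<in>{0<..1}. ennreal (1 / (left_lim (\<lambda>s. M s \<omega>) t + c))
        \<partial>stieltjes_measure (\<lambda>t. A t \<omega>)"
  have S_int: "integrable P (S n)" for n
    unfolding S_def using grid c
    by (intro Bochner_Integration.integrable_sum increment_quotient_integrable) auto
  have A_int: "integrable P (\<lambda>\<omega>. 1 / c * (A 1 \<omega> - A 0 \<omega>))"
    using A_integrable by simp
  have S_bounds: "AE \<omega> in P. \<forall>n. 0 \<le> S n \<omega> \<and> S n \<omega> \<le> 1 / c * (A 1 \<omega> - A 0 \<omega>)"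
    using A_paths AE_space
  proof eventually_elim
    case (elim \<omega>)
    then have mono: "mono_on {0..1} (\<lambda>t. A t \<omega>)" by simp
    have incr: "0 \<le> A (Suc k / n) \<omega> - A (k / n) \<omega>" if "k < n" for k n :: nat
      using mono_onD[OF mono, of "k / n" "Suc k / n"] grid[OF that] by simp
    have weight: "0 \<le> 1 / (M (k / n) \<omega> + c) \<and> 1 / (M (k / n) \<omega> + c) \<le> 1 / c" if "k < n" for k n :: nat
      using M_nonneg[OF grid(1)[OF that], of \<omega>] elim c by (auto intro!: frac_le)
    show ?case
    proof (intro allI conjI)
      fix n :: nat
      show "0 \<le> S n \<omega>"
        unfolding S_def using incr weight by (intro sum_nonneg mult_nonneg_nonneg) auto
      have "S n \<omega> \<le> (\<Sum>k<n. 1 / c * (A (Suc k / n) \<omega> - A (k / n) \<omega>))"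
        unfolding S_def using incr weight by (intro sum_mono mult_right_mono) auto
      also have "\<dots> = 1 / c * (\<Sum>k<n. A (Suc k / n) \<omega> - A (k / n) \<omega>)"
        by (rule sum_distrib_left[symmetric])
      also have "(\<Sum>k<n. A (Suc k / n) \<omega> - A (k / n) \<omega>) = A (real n / n) \<omega> - A 0 \<omega>"
        using sum_lessThan_telescope[of "\<lambda>k. A (real k / n) \<omega>" n] by simp
      also have "1 / c * \<dots> \<le> 1 / c * (A 1 \<omega> - A 0 \<omega>)"
        using mono_onD[OF mono, of 0 1] c by (intro mult_left_mono) (cases "n = 0"; simp)+
      finally show "S n \<omega> \<le> 1 / c * (A 1 \<omega> - A 0 \<omega>)" .
    qed
  qed
  have S_lim: "AE \<omega> in P. (\<lambda>n. ennreal (S n \<omega>)) \<longlonglongrightarrow> ?I \<omega>"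
    using A_paths AE_space
  proof eventually_elim
    case (elim \<omega>)
    show ?case
      unfolding S_def
    proof (rule left_Riemann_sums_tendsto_stieltjes_integral[where C = "1 / c"])
      fix t :: real assume t: "t \<in> {0<..1}"
      show "((\<lambda>s. 1 / (M s \<omega> + c)) \<longlongrightarrow> 1 / (left_lim (\<lambda>s. M s \<omega>) t + c)) (at_left t)"
        using tendsto_left_lim[OF _ t] left_lim_nonneg[OF _ t] elim c
        by (intro tendsto_intros) (auto simp: add_nonneg_eq_0_iff)
    next
      fix t :: real assume "t \<in> {0..1}"
      then show "0 \<le> 1 / (M t \<omega> + c) \<and> 1 / (M t \<omega> + c) \<le> 1 / c"
        using M_nonneg[of t \<omega>] elim c by (auto intro!: frac_le)
    qed (use elim in auto)
  qed
  (* Measurability in \<omega> of the pathwise integral is not known a priori. It agrees almost surely with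
     this lower limit of measurable functions, which takes its place up to the final comparison. *)
  define L where "L \<omega> = liminf (\<lambda>n. ennreal (S n \<omega>))" for \<omega>
  have L_meas: "L \<in> borel_measurable P"
    unfolding L_def using S_int by (auto dest: borel_measurable_integrable)
  have L_eq: "AE \<omega> in P. L \<omega> = ?I \<omega>"
    using S_lim by eventually_elim (simp add: L_def lim_imp_Liminf)
  have lim: "(\<lambda>n. \<integral>\<^sup>+\<omega>. ennreal (S n \<omega>) \<partial>P) \<longlonglongrightarrow> (\<integral>\<^sup>+\<omega>. L \<omega> \<partial>P)"
  proof (rule nn_integral_dominated_convergence[where w = "\<lambda>\<omega>. ennreal (1 / c * (A 1 \<omega> - A 0 \<omega>))"])
    show "AE \<omega> in P. (\<lambda>n. ennreal (S n \<omega>)) \<longlonglongrightarrow> L \<omega>"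
      using S_lim L_eq by eventually_elim simp
    show "AE \<omega> in P. ennreal (S n \<omega>) \<le> ennreal (1 / c * (A 1 \<omega> - A 0 \<omega>))" for n
      using S_bounds by eventually_elim (auto intro: ennreal_leI)
    show "(\<integral>\<^sup>+\<omega>. ennreal (1 / c * (A 1 \<omega> - A 0 \<omega>)) \<partial>P) < \<infinity>"
    proof (subst nn_integral_eq_integral[OF A_int])
      show "AE \<omega> in P. 0 \<le> 1 / c * (A 1 \<omega> - A 0 \<omega>)"
        using S_bounds by eventually_elim (blast intro: order_trans)
    qed simp
  qed (use S_int A_int L_meas in \<open>auto dest: borel_measurable_integrable\<close>)
  have "ennreal ?d \<le> (\<integral>\<^sup>+\<omega>. L \<omega> \<partial>P)"
  proof (rule tendsto_lowerbound[OF lim])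
    show "eventually (\<lambda>n. ennreal ?d \<le> (\<integral>\<^sup>+\<omega>. ennreal (S n \<omega>) \<partial>P)) sequentially"
    proof (rule eventually_sequentiallyI)
      fix n :: nat assume "1 \<le> n"
      then have "?d \<le> (\<integral>\<omega>. S n \<omega> \<partial>P)"
        using expectation_x_ln_x_le_Riemann_sum[OF c, of n] by (simp add: S_def)
      moreover have "(\<integral>\<^sup>+\<omega>. ennreal (S n \<omega>) \<partial>P) = ennreal (\<integral>\<omega>. S n \<omega> \<partial>P)"
        using S_int S_bounds by (intro nn_integral_eq_integral) auto
      ultimately show "ennreal ?d \<le> (\<integral>\<^sup>+\<omega>. ennreal (S n \<omega>) \<partial>P)"
        by (simp add: ennreal_leI)
    qed
  qed auto
  also have "(\<integral>\<^sup>+\<omega>. L \<omega> \<partial>P) \<le> (\<integral>\<^sup>+\<omega>. ?J \<omega> \<partial>P)"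
  proof (rule nn_integral_mono_AE)
    show "AE \<omega> in P. L \<omega> \<le> ?J \<omega>"
      using L_eq AE_space
    proof eventually_elim
      case (elim \<omega>)
      have "ennreal (1 / (left_lim (\<lambda>s. M s \<omega>) t + c)) \<le> 1 / ennreal (left_lim (\<lambda>s. M s \<omega>) t)"
        if t: "t \<in> {0<..1}" for t
      proof (cases "left_lim (\<lambda>s. M s \<omega>) t = 0")
        case True
        then show ?thesis by simp
      next
        case False
        then have pos: "0 < left_lim (\<lambda>s. M s \<omega>) t"
          using left_lim_nonneg[of \<omega> t] elim t by simp
        then have "1 / ennreal (left_lim (\<lambda>s. M s \<omega>) t) = ennreal (1 / left_lim (\<lambda>s. M s \<omega>) t)"
          using divide_ennreal[of 1 "left_lim (\<lambda>s. M s \<omega>) t"] by simp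
        then show ?thesis
          using pos c by (auto intro!: ennreal_leI frac_le)
      qed
      then have "?I \<omega> \<le> ?J \<omega>"
        by (intro nn_integral_mono) (auto simp: indicator_def)
      then show ?case using elim by simp
    qed
  qed
  finally have "ennreal ?d \<le> (\<integral>\<^sup>+\<omega>. ?J \<omega> \<partial>P)" .
  then have bound: "enn2ereal (ennreal ?d) \<le> enn2ereal (\<integral>\<^sup>+\<omega>. ?J \<omega> \<partial>P)"
    by (simp add: less_eq_ennreal.rep_eq)
  have "ereal x \<le> enn2ereal (ennreal x)" for x :: real
  proof (cases "0 \<le> x")
    case False
    then have "ereal x \<le> 0" by simp
    then show ?thesis using enn2ereal_nonneg by (rule order_trans)
  qed simp
  from order_trans[OF this bound] show ?thesis .
qed

end

theorem theorem1:
  fixes P :: "'a measure" and F :: "real \<Rightarrow> 'a measure" and M A :: "real \<Rightarrow> 'a \<Rightarrow> real"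
  assumes "prob_space P"
    and "usual_filtration P F"
    and "\<forall>B\<in>sets (F 0). measure P B = 0 \<or> measure P B = 1"
    and "martingale P F M"
    and "\<forall>t\<in>{0..1}. integrable P (\<lambda>\<omega>. (M t \<omega>)\<^sup>2)"
    and "\<forall>t\<in>{0..1}. \<forall>\<omega>\<in>space P. 0 \<le> M t \<omega>"
    and "\<forall>\<omega>\<in>space P. cadlag (\<lambda>t. M t \<omega>)"
    and "predictable_quadratic_variation P F M A"
  shows "ereal (Ent P (M 1)) \<le>
    enn2ereal (\<integral>\<^sup>+\<omega>. (\<integral>\<^sup>+t\<in>{0<..1}. 1 / ennreal (left_lim (\<lambda>s. M s \<omega>) t)
      \<partial>stieltjes_measure (\<lambda>t. A t \<omega>)) \<partial>P)"
    (is "_ \<le> ?R")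
proof -
  interpret prob_space P by fact
  have A: "AE \<omega> in P. A 0 \<omega> = 0 \<and> mono_on {0..1} (\<lambda>t. A t \<omega>) \<and> right_continuous_path (\<lambda>t. A t \<omega>)"
    using assms(8) by (simp add: predictable_quadratic_variation_def)
  interpret bracketed_cadlag_martingale P F M A
    using assms A
    by unfold_locales
      (auto simp: usual_filtration_def predictable_quadratic_variation_def elim: eventually_mono)
  define m where "m = (\<integral>\<omega>. M 1 \<omega> \<partial>P)"
  have m_nonneg: "0 \<le> m"
    unfolding m_def using M_nonneg[of 1] by (intro integral_nonneg_AE AE_I2) auto
  have m_0: "(\<integral>\<omega>. M 0 \<omega> \<partial>P) = m"
    using martingale_increment_orthogonal[OF \<open>prob_space P\<close> subalgebra M_martingale,
        of 0 1 "\<lambda>_. 1"] M_integrable by (simp add: m_def)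
  have M_0: "AE \<omega> in P. M 0 \<omega> = m"
    using AE_eq_expectation_if_trivial[OF \<open>prob_space P\<close> subalgebra assms(3)
        M_measurable_F M_integrable] by (simp add: m_0)
  have shifted: "ereal ((\<integral>\<omega>. M 1 \<omega> * ln (M 1 \<omega>) \<partial>P) + c * ln c - (m + c) * ln (m + c)) \<le> ?R"
    if c: "0 < c" for c
  proof -
    have int_1: "integrable P (\<lambda>\<omega>. M 1 \<omega> * ln (M 1 \<omega>))"
      using x_ln_x_shift_integrable[of 1 0] by simp
    have "(\<integral>\<omega>. M 1 \<omega> * ln (M 1 \<omega>) \<partial>P) + c * ln c = (\<integral>\<omega>. M 1 \<omega> * ln (M 1 \<omega>) + c * ln c \<partial>P)"
      using int_1 by (simp add: prob_space)
    also have "\<dots> \<le> (\<integral>\<omega>. (M 1 \<omega> + c) * ln (M 1 \<omega> + c) \<partial>P)"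
      using int_1 x_ln_x_shift_integrable[of 1 c] M_nonneg[of 1] c
      by (intro integral_mono x_ln_x_shift_ge) auto
    finally have "(\<integral>\<omega>. M 1 \<omega> * ln (M 1 \<omega>) \<partial>P) + c * ln c
        \<le> (\<integral>\<omega>. (M 1 \<omega> + c) * ln (M 1 \<omega> + c) \<partial>P)" .
    moreover have "(\<integral>\<omega>. (M 0 \<omega> + c) * ln (M 0 \<omega> + c) \<partial>P) = (m + c) * ln (m + c)"
    proof -
      have "(\<integral>\<omega>. (M 0 \<omega> + c) * ln (M 0 \<omega> + c) \<partial>P) = (\<integral>\<omega>. (m + c) * ln (m + c) \<partial>P)"
        using M_0 M_integrable[of 0]
        by (intro integral_cong_AE) (auto dest: borel_measurable_integrable)
      then show ?thesis by (simp add: prob_space)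
    qed
    ultimately have "ereal ((\<integral>\<omega>. M 1 \<omega> * ln (M 1 \<omega>) \<partial>P) + c * ln c - (m + c) * ln (m + c))
      \<le> ereal ((\<integral>\<omega>. (M 1 \<omega> + c) * ln (M 1 \<omega> + c) \<partial>P) - (\<integral>\<omega>. (M 0 \<omega> + c) * ln (M 0 \<omega> + c) \<partial>P))"
      by simp
    also have "\<dots> \<le> ?R" by (rule expectation_x_ln_x_shift_le[OF c])
    finally show ?thesis .
  qed
  have "((\<lambda>c. (\<integral>\<omega>. M 1 \<omega> * ln (M 1 \<omega>) \<partial>P) + c * ln c - (m + c) * ln (m + c))
      \<longlongrightarrow> (\<integral>\<omega>. M 1 \<omega> * ln (M 1 \<omega>) \<partial>P) + 0 - m * ln m) (at_right 0)"
    using tendsto_x_ln_x_shift[of 0]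
    by (intro tendsto_intros tendsto_x_ln_x_shift[OF m_nonneg]) auto
  then have "((\<lambda>c. ereal ((\<integral>\<omega>. M 1 \<omega> * ln (M 1 \<omega>) \<partial>P) + c * ln c - (m + c) * ln (m + c)))
      \<longlongrightarrow> ereal (Ent P (M 1))) (at_right 0)"
    by (simp add: Ent_def m_def)
  then show ?thesis
  proof (rule tendsto_upperbound)
    show "eventually (\<lambda>c. ereal ((\<integral>\<omega>. M 1 \<omega> * ln (M 1 \<omega>) \<partial>P) + c * ln c - (m + c) * ln (m + c)) \<le> ?R)
        (at_right 0)"
      using shifted by (intro eventually_at_rightI[of 0 1]) auto
  qed auto
qed

end
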